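(* Consider a Chaplygin nonholonomic system with constraint phase space $\mathcal M$ (coordinates $(q^\mu,p_\mu)$), non-degenerate fundamental 2-form $$\Omega=dp_\mu\wedge dq^\mu+\tfrac12R^\alpha_{\mu\nu}p_\alpha\,dq^\mu\wedge dq^\nu,$$ and associated almost Poisson bracket $[\cdot,\cdot]$ on $\mathcal M$. Suppose that the system has a symplectic structure, i.e. $d\Omega=0$ (so that $[\cdot,\cdot]$ is a Poisson bracket). Then $[\cdot,\cdot]$ decomposes as $$[f,g]=\{f,g\}+[\![f,g]\!],\qquad \{f,g\}=\frac{\partial f}{\partial q^\mu}\frac{\partial g}{\partial p_\mu}-\frac{\partial f}{\partial p_\mu}\frac{\partial g}{\partial q^\mu},\qquad [\![f,g]\!]=R^\alpha_{\mu\nu}p_\alpha\frac{\partial f}{\partial p_\mu}\frac{\partial g}{\partial p_\nu},$$ i.e. as the sum of the canonical Poisson bracket $\{\cdot,\cdot\}$ and the (non-canonical) bracket $[\![\cdot,\cdot]\!]$, and $[\![\cdot,\cdot]\!]$ is a Poisson bracket.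
   Context: Summation over repeated indices is used. The configuration manifold $Q$ has dimension $n$ with local coordinates $(q^\mu,q^\alpha)$, where $\mu,\nu,\ldots$ take $n-g$ values and $\alpha,\beta,\ldots$ take $g$ values. A Chaplygin nonholonomic system consists of a smooth Lagrangian $L$ on $TQ$ not depending on the coordinates $q^\alpha$, together with linear constraints $\dot q^\alpha=B^\alpha_\mu(q^\nu)\dot q^\mu$, with $B^\alpha_\mu$ smooth functions of the $q^\nu$ only. Put $$R^\alpha_{\mu\nu}=\frac{\partial B^\alpha_\mu}{\partial q^\nu}-\frac{\partial B^\alpha_\nu}{\partial q^\mu}.$$ Let $\mathcal L(q^\mu,\dot q^\mu)$ be the restriction of $L$ to the constraints (substitute $\dot q^\alpha=B^\alpha_\mu\dot q^\mu$), assumed regular, and let $p_\mu=\partial\mathcal L/\partial\dot q^\mu$ be the Legendre transformation, assumed to be a diffeomorphism onto the constraint phase space $\mathcal M$, with coordinates $(q^\mu,p_\mu)$. The symbol $p_\alpha$ denotes the function on $\mathcal M$ obtained from $\partial L/\partial\dot q^\alpha$ by restricting to the constraints and expressing the result through $(q^\mu,p_\mu)$ by the Legendre transformation. The almost Poisson bracket on $\mathcal M$ is $[f,g]=\mathbf J^{ij}\frac{\partial f}{\partial x^i}\frac{\partial g}{\partial x^j}$, where $x=(q^\mu,p_\mu)$ and $\mathbf J$ is the inverse of the matrix of $\Omega$; in block form $$\Omega=\begin{pmatrix}R^\alpha_{\mu\nu}p_\alpha&-\delta_{\mu\nu}\\ \delta_{\mu\nu}&0\end{pmatrix},\qquad \mathbf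 J=\begin{pmatrix}0&\delta_{\mu\nu}\\-\delta_{\mu\nu}&R^\alpha_{\mu\nu}p_\alpha\end{pmatrix}.$$ An almost Poisson bracket is an antisymmetric, bilinear bracket on smooth functions satisfying the Leibniz rule; it is a Poisson bracket if it also satisfies the Jacobi identity. *)

theory Defs
  imports "HOL-Analysis.Analysis"
begin

section \<open>Smooth maps\<close>

(* Both notions are meant for open S.  Ck_on k S f says that all iterated directional
   derivatives of order at most k exist on S and are continuous there. *)
primrec Ck_on :: "nat \<Rightarrow> 'a::euclidean_space set \<Rightarrow> ('a \<Rightarrow> 'b::euclidean_space) \<Rightarrow> bool" where
  "Ck_on 0 S f \<longleftrightarrow> continuous_on S f"
| "Ck_on (Suc k) S f \<longleftrightarrow>
     f differentiable_on S \<and> (\<forall>v. Ck_on k S (\<lambda>x. frechet_derivative f (at x) v))"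

definition smooth_on :: "'a::euclidean_space set \<Rightarrow> ('a \<Rightarrow> 'b::euclidean_space) \<Rightarrow> bool" where
  "smooth_on S f \<longleftrightarrow> (\<forall>k. Ck_on k S f)"

definition diffeomorphism ::
  "'a::euclidean_space set \<Rightarrow> 'b::euclidean_space set \<Rightarrow> ('a \<Rightarrow> 'b) \<Rightarrow> bool" where
  "diffeomorphism S T f \<longleftrightarrow> open S \<and> open T \<and> bij_betw f S T \<and>
     smooth_on S f \<and> smooth_on T (the_inv_into S f)"


section \<open>Differential forms on an open set of a Euclidean space\<close>

definition wedge :: "('a \<Rightarrow> real) \<Rightarrow> ('a \<Rightarrow> real) \<Rightarrow> 'a \<Rightarrow> 'a \<Rightarrow> real" where
  "wedge \<alpha> \<beta> u v = \<alpha> u * \<beta> v - \<alpha> v * \<beta> u"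

(* A 2-form is a function \<omega>, with \<omega> x u v its value at the point x on the vectors u, v.
   Since u, v, w are constant vector fields, no Lie bracket terms occur. *)
definition ext_deriv2 ::
  "('a::real_normed_vector \<Rightarrow> 'a \<Rightarrow> 'a \<Rightarrow> real) \<Rightarrow> 'a \<Rightarrow> 'a \<Rightarrow> 'a \<Rightarrow> 'a \<Rightarrow> real" where
  "ext_deriv2 \<omega> x u v w =
     frechet_derivative (\<lambda>y. \<omega> y v w) (at x) u
   - frechet_derivative (\<lambda>y. \<omega> y u w) (at x) v
   + frechet_derivative (\<lambda>y. \<omega> y u v) (at x) w"

definition closed_form2_on ::
  "'a::real_normed_vector set \<Rightarrow> ('a \<Rightarrow> 'a \<Rightarrow> 'a \<Rightarrow> real) \<Rightarrow> bool" where
  "closed_form2_on M \<omega> \<longleftrightarrow> (\<forall>x\<in>M. \<forall>u v w. ext_deriv2 \<omega> x u v w = 0)"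


section \<open>Almost Poisson and Poisson brackets on the smooth functions on an open set\<close>

(* Functions on M are represented by total functions of which only the values on M matter;
   the first two clauses make br an operation on the smooth functions on M. *)
definition almost_poisson_on ::
  "'a::euclidean_space set \<Rightarrow> (('a \<Rightarrow> real) \<Rightarrow> ('a \<Rightarrow> real) \<Rightarrow> 'a \<Rightarrow> real) \<Rightarrow> bool" where
  "almost_poisson_on M br \<longleftrightarrow>
     (\<forall>f g. smooth_on M f \<longrightarrow> smooth_on M g \<longrightarrow> smooth_on M (br f g)) \<and>
     (\<forall>f f' g g'. smooth_on M f \<longrightarrow> smooth_on M g \<longrightarrow>
        (\<forall>x\<in>M. f x = f' x) \<longrightarrow> (\<forall>x\<in>M. g x = g' x) \<longrightarrow> (\<forall>x\<in>M. br f g x = br f' g' x)) \<and>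
     (\<forall>f g. smooth_on M f \<longrightarrow> smooth_on M g \<longrightarrow> (\<forall>x\<in>M. br f g x = - br g f x)) \<and>
     (\<forall>f g h a b. smooth_on M f \<longrightarrow> smooth_on M g \<longrightarrow> smooth_on M h \<longrightarrow>
        (\<forall>x\<in>M. br (\<lambda>y. a * f y + b * g y) h x = a * br f h x + b * br g h x) \<and>
        (\<forall>x\<in>M. br h (\<lambda>y. a * f y + b * g y) x = a * br h f x + b * br h g x)) \<and>
     (\<forall>f g h. smooth_on M f \<longrightarrow> smooth_on M g \<longrightarrow> smooth_on M h \<longrightarrow>
        (\<forall>x\<in>M. br (\<lambda>y. f y * g y) h x = f x * br g h x + g x * br f h x))"

definition poisson_on ::
  "'a::euclidean_space set \<Rightarrow> (('a \<Rightarrow> real) \<Rightarrow> ('a \<Rightarrow> real) \<Rightarrow> 'a \<Rightarrow> real) \<Rightarrow> bool" where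
  "poisson_on M br \<longleftrightarrow> almost_poisson_on M br \<and>
     (\<forall>f g h. smooth_on M f \<longrightarrow> smooth_on M g \<longrightarrow> smooth_on M h \<longrightarrow>
        (\<forall>x\<in>M. br (br f g) h x + br (br g h) f x + br (br h f) g x = 0))"


section \<open>Chaplygin systems\<close>

(* Indices \<mu>, \<nu> range over 'm, indices \<alpha> over 'g, so n = CARD('m) + CARD('g).
   Q is the open set of R^n on which the coordinates (q, s) = (q^\<mu>, q^\<alpha>) take their values, and
   a point of TQ is ((q, s), (v, w)), where v, w are the velocities of q, s.
   The matrix B q has the entries B^\<alpha>_\<mu>(q) = B q $ \<alpha> $ \<mu>, so the constraints are w = B q *v v. *)

type_synonym ('m, 'g) config = "(real^'m) \<times> (real^'g)"
type_synonym ('m, 'g) lagrangian = "('m, 'g) config \<times> ('m, 'g) config \<Rightarrow> real"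
type_synonym ('m, 'g) constraint = "real^'m \<Rightarrow> real^'m^'g"
type_synonym 'm phase = "(real^'m) \<times> (real^'m)"

definition chaplygin_system ::
  "('m::finite, 'g::finite) config set \<Rightarrow> ('m, 'g) lagrangian \<Rightarrow> ('m, 'g) constraint \<Rightarrow> bool" where
  "chaplygin_system Q L B \<longleftrightarrow>
     open Q \<and> smooth_on (Q \<times> UNIV) L \<and>
     (\<forall>q s s' v w. (q, s) \<in> Q \<longrightarrow> (q, s') \<in> Q \<longrightarrow> L ((q, s), (v, w)) = L ((q, s'), (v, w))) \<and>
     smooth_on (fst ` Q) B"

definition curvature ::
  "('m::finite, 'g::finite) constraint \<Rightarrow> 'g \<Rightarrow> 'm \<Rightarrow> 'm \<Rightarrow> real^'m \<Rightarrow> real" where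
  "curvature B \<alpha> \<mu> \<nu> q =
     frechet_derivative (\<lambda>q. B q $ \<alpha> $ \<mu>) (at q) (axis \<nu> 1)
   - frechet_derivative (\<lambda>q. B q $ \<alpha> $ \<nu>) (at q) (axis \<mu> 1)"

(* L does not depend on s, so any s with (q, s) in Q may be inserted. *)
definition fibre_point :: "('m::finite, 'g::finite) config set \<Rightarrow> real^'m \<Rightarrow> real^'g" where
  "fibre_point Q q = (SOME s. (q, s) \<in> Q)"

definition reduced_lagrangian ::
  "('m::finite, 'g::finite) config set \<Rightarrow> ('m, 'g) lagrangian \<Rightarrow> ('m, 'g) constraint \<Rightarrow>
   real^'m \<Rightarrow> real^'m \<Rightarrow> real" where
  "reduced_lagrangian Q L B q v = L ((q, fibre_point Q q), (v, B q *v v))"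

definition velocity_gradient :: "(real^'m::finite \<Rightarrow> real^'m \<Rightarrow> real) \<Rightarrow> real^'m \<Rightarrow> real^'m \<Rightarrow> real^'m" where
  "velocity_gradient \<L> q v = (\<chi> \<mu>. frechet_derivative (\<L> q) (at v) (axis \<mu> 1))"

definition regular_lagrangian_on :: "(real^'m::finite) set \<Rightarrow> (real^'m \<Rightarrow> real^'m \<Rightarrow> real) \<Rightarrow> bool" where
  "regular_lagrangian_on U \<L> \<longleftrightarrow> (\<forall>q\<in>U. \<forall>v. invertible
     ((\<chi> \<mu> \<nu>. frechet_derivative (\<lambda>v. velocity_gradient \<L> q v $ \<mu>) (at v) (axis \<nu> 1)) :: real^'m^'m))"

definition legendre ::
  "('m::finite, 'g::finite) config set \<Rightarrow> ('m, 'g) lagrangian \<Rightarrow> ('m, 'g) constraint \<Rightarrow>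
   'm phase \<Rightarrow> 'm phase" where
  "legendre Q L B = (\<lambda>(q, v). (q, velocity_gradient (reduced_lagrangian Q L B) q v))"

(* The function p_\<alpha> in the coordinates (q^\<mu>, p_\<mu>). *)
definition constraint_momentum ::
  "('m::finite, 'g::finite) config set \<Rightarrow> ('m, 'g) lagrangian \<Rightarrow> ('m, 'g) constraint \<Rightarrow>
   'g \<Rightarrow> 'm phase \<Rightarrow> real" where
  "constraint_momentum Q L B \<alpha> x =
     (let (q, v) = the_inv_into (fst ` Q \<times> UNIV) (legendre Q L B) x
      in frechet_derivative (\<lambda>w. L ((q, fibre_point Q q), (v, w))) (at (B q *v v)) (axis \<alpha> 1))"

(* The coefficients R^\<alpha>_{\<mu>\<nu>} p_\<alpha>, summed over \<alpha>. *)
definition gyro ::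
  "('m::finite, 'g::finite) config set \<Rightarrow> ('m, 'g) lagrangian \<Rightarrow> ('m, 'g) constraint \<Rightarrow>
   'm phase \<Rightarrow> 'm \<Rightarrow> 'm \<Rightarrow> real" where
  "gyro Q L B x \<mu> \<nu> = (\<Sum>\<alpha>\<in>UNIV. curvature B \<alpha> \<mu> \<nu> (fst x) * constraint_momentum Q L B \<alpha> x)"


section \<open>The fundamental 2-form and the brackets\<close>

(* The coordinates of phase space are indexed by 'm + 'm: Inl \<mu> for q^\<mu>, Inr \<mu> for p_\<mu>. *)
definition coord_vec :: "'m::finite + 'm \<Rightarrow> 'm phase" where
  "coord_vec i = (case i of Inl \<mu> \<Rightarrow> (axis \<mu> 1, 0) | Inr \<mu> \<Rightarrow> (0, axis \<mu> 1))"

definition coord_deriv :: "'m::finite + 'm \<Rightarrow> ('m phase \<Rightarrow> real) \<Rightarrow> 'm phase \<Rightarrow> real" where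
  "coord_deriv i f x = frechet_derivative f (at x) (coord_vec i)"

definition dq :: "'m::finite \<Rightarrow> 'm phase \<Rightarrow> real" where "dq \<mu> u = fst u $ \<mu>"
definition dp :: "'m::finite \<Rightarrow> 'm phase \<Rightarrow> real" where "dp \<mu> u = snd u $ \<mu>"

definition fundamental_form ::
  "('m::finite, 'g::finite) config set \<Rightarrow> ('m, 'g) lagrangian \<Rightarrow> ('m, 'g) constraint \<Rightarrow>
   'm phase \<Rightarrow> 'm phase \<Rightarrow> 'm phase \<Rightarrow> real" where
  "fundamental_form Q L B x u v =
     (\<Sum>\<mu>\<in>UNIV. wedge (dp \<mu>) (dq \<mu>) u v)
   + 1/2 * (\<Sum>\<mu>\<in>UNIV. \<Sum>\<nu>\<in>UNIV. gyro Q L B x \<mu> \<nu> * wedge (dq \<mu>) (dq \<nu>) u v)"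

definition form_matrix :: "('m::finite phase \<Rightarrow> 'm phase \<Rightarrow> real) \<Rightarrow> real^('m + 'm)^('m + 'm)" where
  "form_matrix \<omega> = (\<chi> i j. \<omega> (coord_vec i) (coord_vec j))"

definition almost_poisson_bracket ::
  "('m::finite, 'g::finite) config set \<Rightarrow> ('m, 'g) lagrangian \<Rightarrow> ('m, 'g) constraint \<Rightarrow>
   ('m phase \<Rightarrow> real) \<Rightarrow> ('m phase \<Rightarrow> real) \<Rightarrow> 'm phase \<Rightarrow> real" where
  "almost_poisson_bracket Q L B f g x =
     (\<Sum>i\<in>UNIV. \<Sum>j\<in>UNIV. matrix_inv (form_matrix (fundamental_form Q L B x)) $ i $ j
        * coord_deriv i f x * coord_deriv j g x)"

definition canonical_bracket ::
  "('m::finite phase \<Rightarrow> real) \<Rightarrow> ('m phase \<Rightarrow> real) \<Rightarrow> 'm phase \<Rightarrow> real" where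
  "canonical_bracket f g x =
     (\<Sum>\<mu>\<in>UNIV. coord_deriv (Inl \<mu>) f x * coord_deriv (Inr \<mu>) g x
               - coord_deriv (Inr \<mu>) f x * coord_deriv (Inl \<mu>) g x)"

definition gyro_bracket ::
  "('m::finite, 'g::finite) config set \<Rightarrow> ('m, 'g) lagrangian \<Rightarrow> ('m, 'g) constraint \<Rightarrow>
   ('m phase \<Rightarrow> real) \<Rightarrow> ('m phase \<Rightarrow> real) \<Rightarrow> 'm phase \<Rightarrow> real" where
  "gyro_bracket Q L B f g x =
     (\<Sum>\<mu>\<in>UNIV. \<Sum>\<nu>\<in>UNIV. gyro Q L B x \<mu> \<nu> * coord_deriv (Inr \<mu>) f x * coord_deriv (Inr \<nu>) g x)"


section \<open>Block form of the matrices\<close>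

lemma gyro_antisym: "gyro Q L B x \<nu> \<mu> = - gyro Q L B x \<mu> \<nu>"
  by (simp add: gyro_def curvature_def sum_negf [symmetric] algebra_simps)

lemma fundamental_matrix_blocks:
  "form_matrix (fundamental_form Q L B x) =
     (\<chi> i j. case (i, j) of
        (Inl \<mu>, Inl \<nu>) \<Rightarrow> gyro Q L B x \<mu> \<nu>
      | (Inl \<mu>, Inr \<nu>) \<Rightarrow> - (if \<mu> = \<nu> then 1 else 0)
      | (Inr \<mu>, Inl \<nu>) \<Rightarrow> (if \<mu> = \<nu> then 1 else 0)
      | (Inr \<mu>, Inr \<nu>) \<Rightarrow> 0)"
proof -
  have pick: "(\<Sum>\<mu>'\<in>UNIV. \<Sum>\<nu>'\<in>UNIV. gyro Q L B x \<mu>' \<nu>' *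
      (axis a 1 $ \<mu>' * axis b 1 $ \<nu>')) = gyro Q L B x a b" for a b
  proof -
    have "(\<Sum>\<mu>'\<in>UNIV. \<Sum>\<nu>'\<in>UNIV. gyro Q L B x \<mu>' \<nu>' * (axis a 1 $ \<mu>' * axis b 1 $ \<nu>'))
      = (\<Sum>\<mu>'\<in>UNIV. \<Sum>\<nu>'\<in>UNIV. if \<nu>' = b then (if \<mu>' = a then gyro Q L B x \<mu>' \<nu>' else 0) else 0)"
      by (intro sum.cong refl) (auto simp: axis_def)
    then show ?thesis by simp
  qed
  have qq: "fundamental_form Q L B x (coord_vec (Inl \<mu>)) (coord_vec (Inl \<nu>)) = gyro Q L B x \<mu> \<nu>" for \<mu> \<nu>
    using gyro_antisym [of Q L B x \<nu> \<mu>]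
    by (simp add: fundamental_form_def coord_vec_def wedge_def dq_def dp_def right_diff_distrib
        sum_subtractf pick)
  have delta: "(\<Sum>\<mu>'\<in>UNIV. axis a (1::real) $ \<mu>' * axis b 1 $ \<mu>') = (if a = b then 1 else 0)" for a b :: 'a
  proof -
    have "(\<Sum>\<mu>'\<in>UNIV. axis a (1::real) $ \<mu>' * axis b 1 $ \<mu>') = (\<Sum>\<mu>'\<in>UNIV. if \<mu>' = a then (if a = b then 1 else 0) else 0)"
      by (intro sum.cong refl) (auto simp: axis_def)
    then show ?thesis by simp
  qed
  have qp: "fundamental_form Q L B x (coord_vec (Inl \<mu>)) (coord_vec (Inr \<nu>)) = - (if \<mu> = \<nu> then 1 else 0)"
   and pq: "fundamental_form Q L B x (coord_vec (Inr \<mu>)) (coord_vec (Inl \<nu>)) = (if \<mu> = \<nu> then 1 else 0)"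
   and pp: "fundamental_form Q L B x (coord_vec (Inr \<mu>)) (coord_vec (Inr \<nu>)) = 0" for \<mu> \<nu>
    by (auto simp: fundamental_form_def coord_vec_def wedge_def dq_def dp_def sum_negf delta)
  show ?thesis
    by (simp add: vec_eq_iff form_matrix_def qq qp pq pp split: sum.split)
qed

lemma poisson_matrix_blocks:
  "invertible (form_matrix (fundamental_form Q L B x))" (is ?inv)
  "matrix_inv (form_matrix (fundamental_form Q L B x)) =
     (\<chi> i j. case (i, j) of
        (Inl \<mu>, Inl \<nu>) \<Rightarrow> 0
      | (Inl \<mu>, Inr \<nu>) \<Rightarrow> (if \<mu> = \<nu> then 1 else 0)
      | (Inr \<mu>, Inl \<nu>) \<Rightarrow> - (if \<mu> = \<nu> then 1 else 0)
      | (Inr \<mu>, Inr \<nu>) \<Rightarrow> gyro Q L B x \<mu> \<nu>)" (is "_ = ?J")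
proof -
  let ?W = "form_matrix (fundamental_form Q L B x)"
  have s: "(\<Sum>i\<in>UNIV. h i) = (\<Sum>\<mu>\<in>UNIV. h (Inl \<mu>)) + (\<Sum>\<mu>\<in>UNIV. h (Inr \<mu>))"
    for h :: "'a + 'a \<Rightarrow> real"
    unfolding UNIV_Plus_UNIV [symmetric] by (subst sum.Plus) auto
  have delta1: "(\<Sum>k\<in>UNIV. (if a = k then 1 else 0) * h k) = h a"
    and delta2: "(\<Sum>k\<in>UNIV. h k * (if k = a then 1 else 0)) = h a" for a and h :: "'a \<Rightarrow> real"
    by (simp_all add: mult_delta_left mult_delta_right)
  have 1: "?W ** ?J = mat 1"
  proof -
    have "(?W ** ?J) $ i $ j = mat 1 $ i $ j" for i j
      unfolding fundamental_matrix_blocks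
      by (cases i; cases j)
        (simp_all add: matrix_matrix_mult_def mat_def s sum_negf delta1 delta2)
    then show ?thesis by (simp add: vec_eq_iff)
  qed
  then have 2: "?J ** ?W = mat 1"
    by (rule matrix_left_right_inverse [THEN iffD1])
  show ?inv unfolding invertible_def by (intro exI conjI) (rule 1, rule 2)
  show "matrix_inv ?W = ?J"
    unfolding matrix_inv_def
  proof (rule some_equality)
    show "?W ** ?J = mat 1 \<and> ?J ** ?W = mat 1" using 1 2 by (rule conjI)
  next
    fix K assume K: "?W ** K = mat 1 \<and> K ** ?W = mat 1"
    have "K = K ** (?W ** ?J)" unfolding 1 by (rule matrix_mul_rid [symmetric])
    also have "\<dots> = (K ** ?W) ** ?J" by (rule matrix_mul_assoc)
    also have "K ** ?W = mat 1" using K by (rule conjunct2)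
    also have "mat 1 ** ?J = ?J" by (rule matrix_mul_lid)
    finally show "K = ?J" .
  qed
qed

end

theory Submission
  imports Defs
begin

text \<open>The decomposition of the bracket is read off from the block form of the inverse of \<open>\<Omega>\<close>: the
  off-diagonal blocks give the canonical bracket, the momentum block gives the bracket \<open>[[f, g]]\<close>
  with coefficients \<open>G\<^sub>\<mu>\<^sub>\<nu> = R\<^sup>\<alpha>\<^sub>\<mu>\<^sub>\<nu> p\<^sub>\<alpha>\<close>.

  For any bracket \<open>J\<^sup>i\<^sup>j \<partial>\<^sub>i f \<partial>\<^sub>j g\<close> with smooth antisymmetric coefficients, the second derivatives of
  \<open>f, g, h\<close> cancel in the Jacobi identity, by their symmetry and the antisymmetry of \<open>J\<close>. What
  remains vanishes if the cyclic sum over \<open>i, j, k\<close> of \<open>J\<^sup>l\<^sup>k \<partial>\<^sub>l J\<^sup>i\<^sup>j\<close> is zero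
  (\<open>poisson_on_tensor_bracket\<close>).

  Closedness of \<open>\<Omega>\<close> means that \<open>G\<close> does not depend on the momenta and that the cyclic sum of
  \<open>\<partial>G\<^sub>\<mu>\<^sub>\<nu> / \<partial>q\<^sup>\<kappa>\<close> vanishes (\<open>closed_fundamental_form_components\<close>). Consider now the combination
  \<open>a {f, g} + b [[f, g]]\<close> with constants \<open>a, b\<close>. Only its momentum block \<open>b G\<close> is not constant,
  and only the \<open>q\<close>-derivatives of \<open>G\<close> can be nonzero; those are contracted with the off-diagonal
  block of \<open>J\<close>. So the cyclic condition is \<open>a b\<close> times the cyclic identity for \<open>G\<close>, and the
  whole pencil consists of Poisson brackets (\<open>poisson_on_pencil\<close>). The three brackets in question are
  its members \<open>(a, b) = (1, 1), (1, 0), (0, 1)\<close>.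

  The analytic part is that \<open>G\<close> is smooth on the phase space (\<open>smooth_on_gyro\<close>), for which smooth
  maps are shown to be closed under products and composition.\<close>

section \<open>Smooth maps on open sets\<close>

lemma Ck_on_Suc_open:
  assumes "open S"
  shows "Ck_on (Suc k) S f \<longleftrightarrow>
    (\<forall>x\<in>S. f differentiable (at x)) \<and> (\<forall>v. Ck_on k S (\<lambda>x. frechet_derivative f (at x) v))"
  using assms by (simp add: differentiable_on_eq_differentiable_at)

lemma frechet_derivative_cong_open:
  assumes "open S" "x \<in> S" "f differentiable (at x)" "\<And>y. y \<in> S \<Longrightarrow> f y = g y"
  shows "frechet_derivative f (at x) = frechet_derivative g (at x)"
  using assms by (intro frechet_derivative_transform_within_open[of _ _ S]) auto

lemma differentiable_cong_open:
  assumes "open S" "x \<in> S" "f differentiable (at x)" "\<And>y. y \<in> S \<Longrightarrow> f y = g y"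
  shows "g differentiable (at x)"
  using assms unfolding differentiable_def by (metis has_derivative_transform_within_open)

lemma Ck_on_cong:
  assumes "open S" "\<And>x. x \<in> S \<Longrightarrow> f x = g x" "Ck_on k S f"
  shows "Ck_on k S g"
  using assms
proof (induction k arbitrary: f g)
  case 0
  then show ?case by (auto cong: continuous_on_cong)
next
  case (Suc k)
  have diff: "f differentiable (at x)" if "x \<in> S" for x
    using Suc.prems that by (simp add: Ck_on_Suc_open del: Ck_on.simps)
  have 1: "g differentiable (at x)" if "x \<in> S" for x
    using differentiable_cong_open[OF \<open>open S\<close> that diff[OF that]] Suc.prems(2) by blast
  have "Ck_on k S (\<lambda>x. frechet_derivative g (at x) v)" for v
  proof (rule Suc.IH[OF \<open>open S\<close>])
    show "Ck_on k S (\<lambda>x. frechet_derivative f (at x) v)"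
      using Suc.prems by simp
    show "frechet_derivative f (at x) v = frechet_derivative g (at x) v" if "x \<in> S" for x
      using frechet_derivative_cong_open[OF \<open>open S\<close> that diff[OF that]] Suc.prems(2) by metis
  qed
  with 1 show ?case by (simp add: Ck_on_Suc_open[OF \<open>open S\<close>] del: Ck_on.simps)
qed

lemma Ck_on_imp_continuous_on: "Ck_on k S f \<Longrightarrow> continuous_on S f"
  by (cases k) (auto intro: differentiable_imp_continuous_on)

lemma Ck_on_SucD: "Ck_on (Suc k) S f \<Longrightarrow> Ck_on k S f"
proof (induction k arbitrary: f)
  case 0
  then show ?case using Ck_on_imp_continuous_on by fastforce
next
  case (Suc k)
  then show ?case by (metis Ck_on.simps(2))
qed

text \<open>Being of class \<open>C\<^sup>k\<close> is local. The neighbourhoods \<open>U\<close> need not lie in \<open>S\<close>.\<close>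

lemma Ck_on_local:
  assumes "open S" "\<And>x. x \<in> S \<Longrightarrow> \<exists>U. open U \<and> x \<in> U \<and> Ck_on k U f"
  shows "Ck_on k S f"
  using assms(2)
proof (induction k arbitrary: f)
  case 0
  then show ?case
    by (metis Ck_on.simps(1) continuous_at_imp_continuous_on continuous_on_eq_continuous_at)
next
  case (Suc k)
  have "f differentiable (at x)" if "x \<in> S" for x
    using Suc.prems[OF that] by (metis Ck_on_Suc_open)
  moreover have "Ck_on k S (\<lambda>x. frechet_derivative f (at x) v)" for v
    by (rule Suc.IH) (metis Ck_on.simps(2) Suc.prems)
  ultimately show ?case by (simp add: Ck_on_Suc_open[OF \<open>open S\<close>] del: Ck_on.simps)
qed

lemma Ck_on_subset:
  assumes "T \<subseteq> S" "Ck_on k S f"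
  shows "Ck_on k T f"
  using assms(2)
  by (induction k arbitrary: f)
    (auto intro: continuous_on_subset[OF _ assms(1)] differentiable_on_subset[OF _ assms(1)])

lemma Ck_on_const: "Ck_on k S (\<lambda>x. c)"
  by (induction k arbitrary: c) auto

lemma Ck_on_ident: "Ck_on k S (\<lambda>x. x)"
  by (cases k) (auto simp: Ck_on_const differentiable_on_def)

text \<open>A candidate for the derivative which is of class \<open>C\<^sup>k\<close> in every direction makes a map
  of class \<open>C\<^bsup>k+1\<^esup>\<close>.\<close>

lemma Ck_on_SucI:
  assumes "open S" "\<And>x. x \<in> S \<Longrightarrow> (f has_derivative f' x) (at x)" "\<And>v. Ck_on k S (\<lambda>x. f' x v)"
  shows "Ck_on (Suc k) S f"
proof -
  have eq: "f' x = frechet_derivative f (at x)" if "x \<in> S" for x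
    using assms(2)[OF that] by (rule frechet_derivative_at)
  have "Ck_on k S (\<lambda>x. frechet_derivative f (at x) v)" for v
    by (rule Ck_on_cong[OF assms(1) _ assms(3)[of v]]) (simp add: eq)
  then show ?thesis
    using assms(1,2) by (auto simp: Ck_on_Suc_open differentiable_def simp del: Ck_on.simps)
qed

lemma Ck_on_has_derivative:
  assumes "open S" "Ck_on (Suc k) S f" "x \<in> S"
  shows "(f has_derivative frechet_derivative f (at x)) (at x)"
  using assms by (metis Ck_on_Suc_open frechet_derivative_works)

lemma Ck_on_linear:
  assumes "open S" "bounded_linear l" "Ck_on k S f"
  shows "Ck_on k S (\<lambda>x. l (f x))"
  using assms(3)
proof (induction k arbitrary: f)
  case 0
  then show ?case by (simp add: bounded_linear.continuous_on[OF assms(2)])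
next
  case (Suc k)
  show ?case
  proof (rule Ck_on_SucI[OF assms(1)])
    show "((\<lambda>x. l (f x)) has_derivative (\<lambda>v. l (frechet_derivative f (at x) v))) (at x)" if "x \<in> S" for x
      using bounded_linear.has_derivative[OF assms(2) Ck_on_has_derivative[OF assms(1) Suc.prems that]] .
    show "Ck_on k S (\<lambda>x. l (frechet_derivative f (at x) v))" for v
      using Suc.prems by (intro Suc.IH) simp
  qed
qed

lemma Ck_on_add:
  assumes "open S" "Ck_on k S f" "Ck_on k S g"
  shows "Ck_on k S (\<lambda>x. f x + g x)"
  using assms(2,3)
proof (induction k arbitrary: f g)
  case 0
  then show ?case by (simp add: continuous_on_add)
next
  case (Suc k)
  show ?case
  proof (rule Ck_on_SucI[OF assms(1)])
    show "((\<lambda>x. f x + g x) has_derivative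
        (\<lambda>v. frechet_derivative f (at x) v + frechet_derivative g (at x) v)) (at x)" if "x \<in> S" for x
      using has_derivative_add[OF Ck_on_has_derivative[OF assms(1) Suc.prems(1) that]
          Ck_on_has_derivative[OF assms(1) Suc.prems(2) that]] .
    show "Ck_on k S (\<lambda>x. frechet_derivative f (at x) v + frechet_derivative g (at x) v)" for v
      using Suc.prems by (intro Suc.IH) simp_all
  qed
qed

lemma Ck_on_bilinear:
  assumes "open S" "bounded_bilinear pr" "Ck_on k S f" "Ck_on k S g"
  shows "Ck_on k S (\<lambda>x. pr (f x) (g x))"
  using assms(3,4)
proof (induction k arbitrary: f g)
  case 0
  then show ?case by (simp add: bounded_bilinear.continuous_on[OF assms(2)])
next
  case (Suc k)
  show ?case
  proof (rule Ck_on_SucI[OF assms(1)])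
    show "((\<lambda>x. pr (f x) (g x)) has_derivative
        (\<lambda>v. pr (f x) (frechet_derivative g (at x) v) + pr (frechet_derivative f (at x) v) (g x))) (at x)"
      if "x \<in> S" for x
      using bounded_bilinear.FDERIV[OF assms(2) Ck_on_has_derivative[OF assms(1) Suc.prems(1) that]
          Ck_on_has_derivative[OF assms(1) Suc.prems(2) that]] .
    show "Ck_on k S (\<lambda>x. pr (f x) (frechet_derivative g (at x) v) + pr (frechet_derivative f (at x) v) (g x))" for v
      using Suc.prems
      by (intro Ck_on_add[OF assms(1)] Suc.IH Ck_on_SucD[OF Suc.prems(1)] Ck_on_SucD[OF Suc.prems(2)]) simp_all
  qed
qed

lemma Ck_on_sum:
  assumes "open S" "\<And>i. i \<in> I \<Longrightarrow> Ck_on k S (f i)"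
  shows "Ck_on k S (\<lambda>x. \<Sum>i\<in>I. f i x)"
  using assms(2)
  by (induction I rule: infinite_finite_induct) (auto intro: Ck_on_const Ck_on_add[OF assms(1)])

text \<open>By the chain rule, the derivative of \<open>g \<circ> f\<close> in a direction \<open>v\<close> is the sum over a basis of
  the products of a component of \<open>Df v\<close> and the composition of a partial derivative of \<open>g\<close>
  with \<open>f\<close>.\<close>

lemma Ck_on_compose:
  fixes f :: "'a::euclidean_space \<Rightarrow> 'b::euclidean_space" and g :: "'b \<Rightarrow> 'c::euclidean_space"
  assumes "open S" "open T" "f ` S \<subseteq> T" "Ck_on k S f" "Ck_on k T g"
  shows "Ck_on k S (\<lambda>x. g (f x))"
  using assms(4,5)
proof (induction k arbitrary: g)
  case 0
  then show ?case using assms(3) by (auto intro: continuous_on_compose2)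
next
  case (Suc k)
  show ?case
  proof (rule Ck_on_SucI[OF assms(1)])
    show "((\<lambda>x. g (f x)) has_derivative (\<lambda>v. \<Sum>b\<in>Basis. (frechet_derivative f (at x) v \<bullet> b) *\<^sub>R
        frechet_derivative g (at (f x)) b)) (at x)" if "x \<in> S" for x
    proof -
      have f: "(f has_derivative frechet_derivative f (at x)) (at x)"
        by (rule Ck_on_has_derivative[OF assms(1) Suc.prems(1) that])
      have "f x \<in> T" using that assms(3) by blast
      then have g: "(g has_derivative frechet_derivative g (at (f x))) (at (f x))"
        by (rule Ck_on_has_derivative[OF assms(2) Suc.prems(2)])
      have lin: "linear (frechet_derivative g (at (f x)))"
        using g has_derivative_linear by blast
      have "frechet_derivative g (at (f x)) w =
          (\<Sum>b\<in>Basis. (w \<bullet> b) *\<^sub>R frechet_derivative g (at (f x)) b)" for w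
      proof -
        have "frechet_derivative g (at (f x)) w =
            frechet_derivative g (at (f x)) (\<Sum>b\<in>Basis. (w \<bullet> b) *\<^sub>R b)"
          by (simp add: euclidean_representation)
        also have "\<dots> = (\<Sum>b\<in>Basis. (w \<bullet> b) *\<^sub>R frechet_derivative g (at (f x)) b)"
          by (simp add: linear_sum[OF lin] linear_cmul[OF lin])
        finally show ?thesis .
      qed
      then have "frechet_derivative g (at (f x)) \<circ> frechet_derivative f (at x) =
          (\<lambda>v. \<Sum>b\<in>Basis. (frechet_derivative f (at x) v \<bullet> b) *\<^sub>R frechet_derivative g (at (f x)) b)"
        unfolding o_def by blast
      with diff_chain_at[OF f g] show ?thesis
        by (simp only: o_def)
    qed
    show "Ck_on k S (\<lambda>x. \<Sum>b\<in>Basis. (frechet_derivative f (at x) v \<bullet> b) *\<^sub>R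
        frechet_derivative g (at (f x)) b)" for v
    proof (intro Ck_on_sum[OF assms(1)] Ck_on_bilinear[OF assms(1) bounded_bilinear_scaleR])
      show "Ck_on k S (\<lambda>x. frechet_derivative f (at x) v \<bullet> b)" for b
        using Suc.prems by (intro Ck_on_linear[OF assms(1) bounded_linear_inner_left]) simp
      show "Ck_on k S (\<lambda>x. frechet_derivative g (at (f x)) b)" for b
        using Suc.prems(2) by (intro Suc.IH Ck_on_SucD[OF Suc.prems(1)]) simp
    qed
  qed
qed

lemma smooth_on_cong: "open S \<Longrightarrow> (\<And>x. x \<in> S \<Longrightarrow> f x = g x) \<Longrightarrow> smooth_on S f \<Longrightarrow> smooth_on S g"
  unfolding smooth_on_def by (metis Ck_on_cong)

lemma smooth_on_local:
  "open S \<Longrightarrow> (\<And>x. x \<in> S \<Longrightarrow> \<exists>U. open U \<and> x \<in> U \<and> smooth_on U f) \<Longrightarrow> smooth_on S f"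
  unfolding smooth_on_def by (metis Ck_on_local)

lemma smooth_on_subset: "T \<subseteq> S \<Longrightarrow> smooth_on S f \<Longrightarrow> smooth_on T f"
  unfolding smooth_on_def by (metis Ck_on_subset)

lemma smooth_on_const: "smooth_on S (\<lambda>x. c)"
  by (simp add: smooth_on_def Ck_on_const)

lemma smooth_on_ident: "smooth_on S (\<lambda>x. x)"
  by (simp add: smooth_on_def Ck_on_ident)

lemma smooth_on_linear: "open S \<Longrightarrow> bounded_linear l \<Longrightarrow> smooth_on S f \<Longrightarrow> smooth_on S (\<lambda>x. l (f x))"
  unfolding smooth_on_def by (metis Ck_on_linear)

lemma smooth_on_add: "open S \<Longrightarrow> smooth_on S f \<Longrightarrow> smooth_on S g \<Longrightarrow> smooth_on S (\<lambda>x. f x + g x)"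
  unfolding smooth_on_def by (metis Ck_on_add)

lemma smooth_on_bilinear:
  "open S \<Longrightarrow> bounded_bilinear pr \<Longrightarrow> smooth_on S f \<Longrightarrow> smooth_on S g \<Longrightarrow> smooth_on S (\<lambda>x. pr (f x) (g x))"
  unfolding smooth_on_def by (metis Ck_on_bilinear)

lemmas smooth_on_mult = smooth_on_bilinear[OF _ bounded_bilinear_mult]

lemma smooth_on_diff:
  assumes "open S" "smooth_on S f" "smooth_on S g"
  shows "smooth_on S (\<lambda>x. f x - g x)"
  using smooth_on_add[OF assms(1,2) smooth_on_linear[OF assms(1) bounded_linear_minus[OF bounded_linear_ident] assms(3)]]
  by simp

lemma smooth_on_sum:
  "open S \<Longrightarrow> (\<And>i. i \<in> I \<Longrightarrow> smooth_on S (f i)) \<Longrightarrow> smooth_on S (\<lambda>x. \<Sum>i\<in>I. f i x)"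
  unfolding smooth_on_def by (metis Ck_on_sum)

lemma smooth_on_compose:
  "open S \<Longrightarrow> open T \<Longrightarrow> f ` S \<subseteq> T \<Longrightarrow> smooth_on S f \<Longrightarrow> smooth_on T g \<Longrightarrow> smooth_on S (\<lambda>x. g (f x))"
  unfolding smooth_on_def by (metis Ck_on_compose)

lemma smooth_on_Pair:
  assumes "open S" "smooth_on S f" "smooth_on S g"
  shows "smooth_on S (\<lambda>x. (f x, g x))"
proof -
  have "bounded_linear (\<lambda>y. (y, 0))" "bounded_linear (\<lambda>y. (0, y))"
    by (intro bounded_linear_Pair bounded_linear_ident bounded_linear_zero)+
  from smooth_on_add[OF assms(1) smooth_on_linear[OF assms(1) this(1) assms(2)]
      smooth_on_linear[OF assms(1) this(2) assms(3)]]
  show ?thesis by simp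
qed

lemma smooth_on_derivative: "smooth_on S f \<Longrightarrow> smooth_on S (\<lambda>x. frechet_derivative f (at x) v)"
  unfolding smooth_on_def by (metis Ck_on.simps(2))

lemma smooth_on_differentiable: "open S \<Longrightarrow> smooth_on S f \<Longrightarrow> x \<in> S \<Longrightarrow> f differentiable (at x)"
  unfolding smooth_on_def by (metis Ck_on_Suc_open)

lemma smooth_on_has_derivative:
  "open S \<Longrightarrow> smooth_on S f \<Longrightarrow> x \<in> S \<Longrightarrow> (f has_derivative frechet_derivative f (at x)) (at x)"
  by (metis smooth_on_differentiable frechet_derivative_works)

lemma smooth_on_continuous_on: "smooth_on S f \<Longrightarrow> continuous_on S f"
  unfolding smooth_on_def by (metis Ck_on.simps(1))

section \<open>Symmetry of the second derivative\<close>

text \<open>The second difference over the parallelogram with sides \<open>h u\<close> and \<open>h v\<close> is \<open>h\<^sup>2\<close> times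
  a mixed second derivative at a point inside, by the mean value theorem in both directions.\<close>

lemma second_difference_mvt:
  fixes f :: "'a::euclidean_space \<Rightarrow> real"
  assumes h: "0 < h"
    and f: "\<And>s t. 0 \<le> s \<Longrightarrow> s \<le> h \<Longrightarrow> 0 \<le> t \<Longrightarrow> t \<le> h \<Longrightarrow> f differentiable (at (x + s *\<^sub>R u + t *\<^sub>R v))"
    and fu: "\<And>s t. 0 \<le> s \<Longrightarrow> s \<le> h \<Longrightarrow> 0 \<le> t \<Longrightarrow> t \<le> h \<Longrightarrow>
      (\<lambda>y. frechet_derivative f (at y) u) differentiable (at (x + s *\<^sub>R u + t *\<^sub>R v))"
  obtains s t where "0 < s" "s < h" "0 < t" "t < h"
    "f (x + h *\<^sub>R u + h *\<^sub>R v) - f (x + h *\<^sub>R u) - f (x + h *\<^sub>R v) + f x =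
      h * (h * frechet_derivative (\<lambda>y. frechet_derivative f (at y) u) (at (x + s *\<^sub>R u + t *\<^sub>R v)) v)"
proof -
  \<comment> \<open>the derivative along a line is the directional derivative\<close>
  have line: "((\<lambda>t. F (a + t *\<^sub>R w)) has_real_derivative frechet_derivative F (at (a + t *\<^sub>R w)) w) (at t)"
    if "F differentiable (at (a + t *\<^sub>R w))" for F :: "'a \<Rightarrow> real" and a w t
  proof -
    have F: "(F has_derivative frechet_derivative F (at (a + t *\<^sub>R w))) (at (a + t *\<^sub>R w))"
      using that frechet_derivative_works by blast
    have "((\<lambda>t. a + t *\<^sub>R w) has_derivative (\<lambda>k. k *\<^sub>R w)) (at t)"
      by (auto intro!: derivative_eq_intros)
    from diff_chain_at[OF this F]
    have "((\<lambda>t. F (a + t *\<^sub>R w)) has_derivative (\<lambda>k. frechet_derivative F (at (a + t *\<^sub>R w)) (k *\<^sub>R w))) (at t)"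
      by (simp add: o_def)
    moreover have "frechet_derivative F (at (a + t *\<^sub>R w)) (k *\<^sub>R w) = frechet_derivative F (at (a + t *\<^sub>R w)) w * k" for k
      using linear_cmul[OF has_derivative_linear[OF F]] by (simp add: mult.commute)
    ultimately show ?thesis by (simp add: has_field_derivative_def)
  qed
  define g where "g s = f ((x + h *\<^sub>R v) + s *\<^sub>R u) - f (x + s *\<^sub>R u)" for s
  have "(g has_real_derivative frechet_derivative f (at ((x + h *\<^sub>R v) + s *\<^sub>R u)) u
      - frechet_derivative f (at (x + s *\<^sub>R u)) u) (at s)" if "0 \<le> s" "s \<le> h" for s
    unfolding g_def using f[OF that, of h] f[OF that, of 0] h
    by (intro DERIV_diff line) (simp_all add: add_ac)
  from MVT2[OF h this] obtain s where s: "0 < s" "s < h"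
    "g h - g 0 = h * (frechet_derivative f (at ((x + h *\<^sub>R v) + s *\<^sub>R u)) u - frechet_derivative f (at (x + s *\<^sub>R u)) u)"
    by auto
  have "((\<lambda>t. frechet_derivative f (at ((x + s *\<^sub>R u) + t *\<^sub>R v)) u) has_real_derivative
     frechet_derivative (\<lambda>y. frechet_derivative f (at y) u) (at ((x + s *\<^sub>R u) + t *\<^sub>R v)) v) (at t)"
    if "0 \<le> t" "t \<le> h" for t
    using fu[OF _ _ that, of s] s by (intro line) simp
  from MVT2[OF h this] obtain t where t: "0 < t" "t < h"
    "frechet_derivative f (at ((x + s *\<^sub>R u) + h *\<^sub>R v)) u - frechet_derivative f (at (x + s *\<^sub>R u)) u =
      h * frechet_derivative (\<lambda>y. frechet_derivative f (at y) u) (at (x + s *\<^sub>R u + t *\<^sub>R v)) v"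
    by auto
  have comm: "x + h *\<^sub>R v + s *\<^sub>R u = x + s *\<^sub>R u + h *\<^sub>R v" by (simp add: add_ac)
  have "f (x + h *\<^sub>R u + h *\<^sub>R v) - f (x + h *\<^sub>R u) - f (x + h *\<^sub>R v) + f x = g h - g 0"
    by (simp add: g_def add_ac)
  also have "\<dots> = h * (h * frechet_derivative (\<lambda>y. frechet_derivative f (at y) u) (at (x + s *\<^sub>R u + t *\<^sub>R v)) v)"
    unfolding s(3) comm t(3) ..
  finally show ?thesis using that s t by blast
qed

text \<open>Both mixed second derivatives are limits of the same second difference divided by \<open>h\<^sup>2\<close>: the
  value of the one at some point near \<open>x\<close> equals the value of the other at another point near \<open>x\<close>,
  and both are continuous.\<close>

theorem second_derivative_symmetric:
  fixes f :: "'a::euclidean_space \<Rightarrow> real"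
  assumes S: "open S" "x \<in> S" and f: "smooth_on S f"
  shows "frechet_derivative (\<lambda>y. frechet_derivative f (at y) u) (at x) v =
    frechet_derivative (\<lambda>y. frechet_derivative f (at y) v) (at x) u" (is "?A x = ?B x")
proof (rule ccontr)
  assume ne: "?A x \<noteq> ?B x"
  define e where "e = \<bar>?A x - ?B x\<bar> / 2"
  have e: "0 < e" using ne by (simp add: e_def)
  have cont: "isCont ?A x" "isCont ?B x"
    using f S by (auto intro!: continuous_on_interior[of S] smooth_on_continuous_on smooth_on_derivative
        simp: interior_open)
  obtain d1 where d1: "0 < d1" "\<And>y. dist y x < d1 \<Longrightarrow> dist (?A y) (?A x) < e"
    using cont(1) e unfolding continuous_at_eps_delta by blast
  obtain d2 where d2: "0 < d2" "\<And>y. dist y x < d2 \<Longrightarrow> dist (?B y) (?B x) < e"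
    using cont(2) e unfolding continuous_at_eps_delta by blast
  obtain d3 where d3: "0 < d3" "ball x d3 \<subseteq> S"
    using S openE by blast
  define d where "d = min d1 (min d2 d3)"
  have d: "0 < d" using d1 d2 d3 by (simp add: d_def)
  \<comment> \<open>small enough for the parallelogram with sides \<open>h u\<close> and \<open>h v\<close> to lie in the ball of radius \<open>d\<close>\<close>
  define h where "h = d / (2 * (norm u + norm v + 1))"
  have nz: "0 < norm u + norm v + 1" by (simp add: add_nonneg_pos)
  have h: "0 < h" using d nz by (simp add: h_def)
  have close: "dist (x + s *\<^sub>R u + t *\<^sub>R v) x < d" if "0 \<le> s" "s \<le> h" "0 \<le> t" "t \<le> h" for s t
  proof -
    have "dist (x + s *\<^sub>R u + t *\<^sub>R v) x \<le> s * norm u + t * norm v"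
      using that by (simp add: dist_norm add.assoc) (metis norm_triangle_ineq norm_scaleR abs_of_nonneg)
    also have "\<dots> \<le> h * norm u + h * norm v"
      using that by (intro add_mono mult_right_mono) auto
    also have "\<dots> \<le> h * (norm u + norm v + 1)" using h by (simp add: algebra_simps)
    also have "\<dots> = d / 2" using nz by (simp add: h_def field_simps)
    also have "\<dots> < d" using d by simp
    finally show ?thesis .
  qed
  have inS: "x + s *\<^sub>R u + t *\<^sub>R v \<in> S" if "0 \<le> s" "s \<le> h" "0 \<le> t" "t \<le> h" for s t
    using close[OF that] d3(2) by (auto simp: d_def dist_commute)
  have diff: "F differentiable (at (x + s *\<^sub>R u + t *\<^sub>R v))"
    if "smooth_on S F" "0 \<le> s" "s \<le> h" "0 \<le> t" "t \<le> h" for s t and F :: "'a \<Rightarrow> real"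
    using smooth_on_differentiable[OF S(1) that(1)] inS that by blast
  obtain s t where 1: "0 < s" "s < h" "0 < t" "t < h"
    "f (x + h *\<^sub>R u + h *\<^sub>R v) - f (x + h *\<^sub>R u) - f (x + h *\<^sub>R v) + f x = h * (h * ?A (x + s *\<^sub>R u + t *\<^sub>R v))"
    by (rule second_difference_mvt[OF h, of f x u v]) (use diff f smooth_on_derivative in blast)+
  have swap: "x + a *\<^sub>R v + b *\<^sub>R u = x + b *\<^sub>R u + a *\<^sub>R v" for a b by (simp add: add_ac)
  obtain s' t' where 2: "0 < s'" "s' < h" "0 < t'" "t' < h"
    "f (x + h *\<^sub>R v + h *\<^sub>R u) - f (x + h *\<^sub>R v) - f (x + h *\<^sub>R u) + f x = h * (h * ?B (x + s' *\<^sub>R v + t' *\<^sub>R u))"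
    by (rule second_difference_mvt[OF h, of f x v u]) (unfold swap, (use diff f smooth_on_derivative in blast)+)
  have "h * (h * ?A (x + s *\<^sub>R u + t *\<^sub>R v)) = h * (h * ?B (x + t' *\<^sub>R u + s' *\<^sub>R v))"
    using 1(5) 2(5) unfolding swap by linarith
  then have eq: "?A (x + s *\<^sub>R u + t *\<^sub>R v) = ?B (x + t' *\<^sub>R u + s' *\<^sub>R v)" using h by simp
  have "dist (?A (x + s *\<^sub>R u + t *\<^sub>R v)) (?A x) < e"
    using close[of s t] 1 by (intro d1(2)) (auto simp: d_def)
  moreover have "dist (?B (x + t' *\<^sub>R u + s' *\<^sub>R v)) (?B x) < e"
    using close[of t' s'] 2 by (intro d2(2)) (auto simp: d_def)
  ultimately have "\<bar>?A x - ?B x\<bar> < 2 * e"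
    unfolding eq dist_real_def by linarith
  then show False by (simp add: e_def)
qed

section \<open>Brackets given by a bivector\<close>

text \<open>The bracket \<open>J\<^sup>i\<^sup>j \<partial>\<^sub>i f \<partial>\<^sub>j g\<close>, where \<open>\<partial>\<^sub>i\<close> is the derivative in the constant direction \<open>e i\<close>.
  The directions \<open>e i\<close> need not form a basis.\<close>

definition tensor_bracket :: "('i::finite \<Rightarrow> 'a::euclidean_space) \<Rightarrow> ('a \<Rightarrow> 'i \<Rightarrow> 'i \<Rightarrow> real) \<Rightarrow>
    ('a \<Rightarrow> real) \<Rightarrow> ('a \<Rightarrow> real) \<Rightarrow> 'a \<Rightarrow> real" where
  "tensor_bracket e J f g x =
    (\<Sum>i\<in>UNIV. \<Sum>j\<in>UNIV. J x i j * frechet_derivative f (at x) (e i) * frechet_derivative g (at x) (e j))"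

lemma sum4_reorder:
  fixes G :: "'i::finite \<Rightarrow> 'i \<Rightarrow> 'i \<Rightarrow> 'i \<Rightarrow> real"
  shows "(\<Sum>i\<in>UNIV. \<Sum>j\<in>UNIV. \<Sum>k\<in>UNIV. \<Sum>l\<in>UNIV. G l k i j) =
    (\<Sum>l\<in>UNIV. \<Sum>k\<in>UNIV. \<Sum>i\<in>UNIV. \<Sum>j\<in>UNIV. G l k i j)"
proof -
  have "(\<Sum>(i, j, k, l)\<in>UNIV. G l k i j) = (\<Sum>(l, k, i, j)\<in>UNIV. G l k i j)"
    by (rule sum.reindex_bij_witness[of _ "\<lambda>(l, k, i, j). (i, j, k, l)" "\<lambda>(i, j, k, l). (l, k, i, j)"]) auto
  then show ?thesis
    by (simp add: sum.cartesian_product split_def)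
qed

lemma sum3_rotate:
  fixes G :: "'i::finite \<Rightarrow> 'i \<Rightarrow> 'i \<Rightarrow> real"
  shows "(\<Sum>k\<in>UNIV. \<Sum>i\<in>UNIV. \<Sum>j\<in>UNIV. G i j k) = (\<Sum>i\<in>UNIV. \<Sum>j\<in>UNIV. \<Sum>k\<in>UNIV. G i j k)"
proof -
  have "(\<Sum>(k, i, j)\<in>UNIV. G i j k) = (\<Sum>(i, j, k)\<in>UNIV. G i j k)"
    by (rule sum.reindex_bij_witness[of _ "\<lambda>(i, j, k). (k, i, j)" "\<lambda>(k, i, j). (i, j, k)"]) auto
  then show ?thesis
    by (simp add: sum.cartesian_product split_def)
qed

text \<open>The Jacobi identity at a point. Here \<open>f, g, h\<close> are the first derivatives of three functions,
  \<open>f2, g2, h2\<close> their second derivatives, and \<open>dJ l i j\<close> is the derivative of \<open>J i j\<close> in direction \<open>l\<close>.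
  The terms with second derivatives cancel in pairs, since these are symmetric and \<open>J\<close> is antisymmetric;
  the remaining terms add up to the cyclic sum of \<open>J l k * dJ l i j\<close>.\<close>

lemma jacobi_pointwise:
  fixes J :: "'i::finite \<Rightarrow> 'i \<Rightarrow> real" and dJ :: "'i \<Rightarrow> 'i \<Rightarrow> 'i \<Rightarrow> real"
    and f g h :: "'i \<Rightarrow> real"
  defines "D \<equiv> (\<lambda>f f2 g g2 l. \<Sum>i\<in>UNIV. \<Sum>j\<in>UNIV.
      dJ l i j * f i * g j + J i j * f2 l i * g j + J i j * f i * g2 l j)"
  assumes J: "\<And>i j. J j i = - J i j"
    and sym: "\<And>i j. f2 i j = f2 j i" "\<And>i j. g2 i j = g2 j i" "\<And>i j. h2 i j = h2 j i"
    and cyc: "\<And>i j k. (\<Sum>l\<in>UNIV. J l k * dJ l i j + J l i * dJ l j k + J l j * dJ l k i) = 0"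
  shows "(\<Sum>l\<in>UNIV. \<Sum>k\<in>UNIV. J l k * D f f2 g g2 l * h k)
    + (\<Sum>l\<in>UNIV. \<Sum>k\<in>UNIV. J l k * D g g2 h h2 l * f k)
    + (\<Sum>l\<in>UNIV. \<Sum>k\<in>UNIV. J l k * D h h2 f f2 l * g k) = 0"
proof -
  define A where "A = (\<lambda>f g h :: 'i \<Rightarrow> real. \<Sum>l\<in>UNIV. \<Sum>k\<in>UNIV. \<Sum>i\<in>UNIV. \<Sum>j\<in>UNIV.
      J l k * dJ l i j * f i * g j * h k)"
  define P where "P = (\<lambda>(f2 :: 'i \<Rightarrow> 'i \<Rightarrow> real) (g :: 'i \<Rightarrow> real) (h :: 'i \<Rightarrow> real).
      \<Sum>l\<in>UNIV. \<Sum>k\<in>UNIV. \<Sum>i\<in>UNIV. \<Sum>j\<in>UNIV. J l k * J i j * f2 l i * g j * h k)"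
  define R where "R = (\<lambda>(f :: 'i \<Rightarrow> real) (g2 :: 'i \<Rightarrow> 'i \<Rightarrow> real) (h :: 'i \<Rightarrow> real).
      \<Sum>l\<in>UNIV. \<Sum>k\<in>UNIV. \<Sum>i\<in>UNIV. \<Sum>j\<in>UNIV. J l k * J i j * f i * g2 l j * h k)"
  have split: "(\<Sum>l\<in>UNIV. \<Sum>k\<in>UNIV. J l k * D f f2 g g2 l * h k) = A f g h + P f2 g h + R f g2 h"
    for f f2 g g2 h
    unfolding A_def P_def R_def D_def sum.distrib [symmetric] sum_distrib_left sum_distrib_right
    by (intro sum.cong refl) (simp add: algebra_simps)
  \<comment> \<open>each second derivative occurs in two of the three iterated brackets\<close>
  have cancel: "P f2 g h + R h f2 g = 0" if "\<And>i j. f2 i j = f2 j i" for f2 g h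
  proof -
    have swap: "J i j * J k l * h k * f2 i l * g j = - (J l k * J i j * f2 l i * g j * h k)" for i j k l
      using J[of l k] that[of i l] by simp
    have "R h f2 g = (\<Sum>l\<in>UNIV. \<Sum>k\<in>UNIV. \<Sum>i\<in>UNIV. \<Sum>j\<in>UNIV. J i j * J k l * h k * f2 i l * g j)"
      unfolding R_def by (rule sum4_reorder)
    also have "\<dots> = (\<Sum>l\<in>UNIV. \<Sum>k\<in>UNIV. \<Sum>i\<in>UNIV. \<Sum>j\<in>UNIV. - (J l k * J i j * f2 l i * g j * h k))"
      by (simp only: swap)
    finally show ?thesis by (simp add: P_def sum_negf)
  qed
  have A: "A f g h = (\<Sum>i\<in>UNIV. \<Sum>j\<in>UNIV. \<Sum>k\<in>UNIV. f i * g j * h k * (\<Sum>l\<in>UNIV. J l k * dJ l i j))"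
    for f g h
  proof -
    have "A f g h = (\<Sum>k\<in>UNIV. \<Sum>i\<in>UNIV. \<Sum>j\<in>UNIV. \<Sum>l\<in>UNIV. J l k * dJ l i j * f i * g j * h k)"
    proof -
      have "(\<Sum>(l, k, i, j)\<in>UNIV. J l k * dJ l i j * f i * g j * h k) =
          (\<Sum>(k, i, j, l)\<in>UNIV. J l k * dJ l i j * f i * g j * h k)"
        by (rule sum.reindex_bij_witness[of _ "\<lambda>(k, i, j, l). (l, k, i, j)" "\<lambda>(l, k, i, j). (k, i, j, l)"]) auto
      then show ?thesis
        by (simp add: A_def sum.cartesian_product split_def)
    qed
    also have "\<dots> = (\<Sum>k\<in>UNIV. \<Sum>i\<in>UNIV. \<Sum>j\<in>UNIV. f i * g j * h k * (\<Sum>l\<in>UNIV. J l k * dJ l i j))"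
      unfolding sum_distrib_left by (intro sum.cong refl) (simp add: mult_ac)
    finally show ?thesis using sum3_rotate by simp
  qed
  have "A f g h + A g h f + A h f g = 0"
  proof -
    have 1: "A g h f = (\<Sum>i\<in>UNIV. \<Sum>j\<in>UNIV. \<Sum>k\<in>UNIV. g j * h k * f i * (\<Sum>l\<in>UNIV. J l i * dJ l j k))"
      unfolding A by (rule sum3_rotate[symmetric])
    have 2: "A h f g = (\<Sum>i\<in>UNIV. \<Sum>j\<in>UNIV. \<Sum>k\<in>UNIV. h k * f i * g j * (\<Sum>l\<in>UNIV. J l j * dJ l k i))"
      unfolding A by (rule sum3_rotate)
    have "A f g h + A g h f + A h f g = (\<Sum>i\<in>UNIV. \<Sum>j\<in>UNIV. \<Sum>k\<in>UNIV. f i * g j * h k *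
        (\<Sum>l\<in>UNIV. J l k * dJ l i j + J l i * dJ l j k + J l j * dJ l k i))"
      unfolding 1 2 unfolding A sum.distrib [symmetric] sum_distrib_left
      by (intro sum.cong refl) (simp add: algebra_simps)
    then show ?thesis by (simp add: cyc)
  qed
  with cancel[of f2 g h, OF sym(1)] cancel[of g2 h f, OF sym(2)] cancel[of h2 f g, OF sym(3)] show ?thesis
    unfolding split by linarith
qed

lemma smooth_on_tensor_bracket:
  assumes "open M" "\<And>i j. smooth_on M (\<lambda>x. J x i j)" "smooth_on M f" "smooth_on M g"
  shows "smooth_on M (tensor_bracket e J f g)"
  unfolding tensor_bracket_def[abs_def]
  by (intro smooth_on_sum smooth_on_mult smooth_on_derivative assms)

lemma frechet_derivative_tensor_bracket:
  assumes M: "open M" "x \<in> M" and J: "\<And>i j. smooth_on M (\<lambda>x. J x i j)"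
    and f: "smooth_on M f" and g: "smooth_on M g"
  shows "frechet_derivative (tensor_bracket e J f g) (at x) v = (\<Sum>i\<in>UNIV. \<Sum>j\<in>UNIV.
      frechet_derivative (\<lambda>y. J y i j) (at x) v * frechet_derivative f (at x) (e i) * frechet_derivative g (at x) (e j)
    + J x i j * frechet_derivative (\<lambda>y. frechet_derivative f (at y) (e i)) (at x) v * frechet_derivative g (at x) (e j)
    + J x i j * frechet_derivative f (at x) (e i) * frechet_derivative (\<lambda>y. frechet_derivative g (at y) (e j)) (at x) v)"
proof -
  note D = smooth_on_has_derivative[OF M(1) _ M(2)]
  have "(tensor_bracket e J f g has_derivative (\<lambda>v. \<Sum>i\<in>UNIV. \<Sum>j\<in>UNIV.
      (J x i j * frechet_derivative f (at x) (e i)) * frechet_derivative (\<lambda>y. frechet_derivative g (at y) (e j)) (at x) v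
    + (J x i j * frechet_derivative (\<lambda>y. frechet_derivative f (at y) (e i)) (at x) v
       + frechet_derivative (\<lambda>y. J y i j) (at x) v * frechet_derivative f (at x) (e i)) * frechet_derivative g (at x) (e j))) (at x)"
    unfolding tensor_bracket_def[abs_def]
    by (intro has_derivative_sum has_derivative_mult D J smooth_on_derivative[OF f] smooth_on_derivative[OF g])
  from frechet_derivative_at[OF this, symmetric] show ?thesis
    by (simp add: algebra_simps)
qed

text \<open>The cyclic condition expresses that the Schouten bracket of the bivector \<open>J\<close> with itself vanishes.\<close>

theorem poisson_on_tensor_bracket:
  fixes e :: "'i::finite \<Rightarrow> 'a::euclidean_space"
  assumes M: "open M" and J: "\<And>i j. smooth_on M (\<lambda>x. J x i j)"
    and anti: "\<And>x i j. x \<in> M \<Longrightarrow> J x j i = - J x i j"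
    and cyc: "\<And>x i j k. x \<in> M \<Longrightarrow> (\<Sum>l\<in>UNIV.
        J x l k * frechet_derivative (\<lambda>y. J y i j) (at x) (e l)
      + J x l i * frechet_derivative (\<lambda>y. J y j k) (at x) (e l)
      + J x l j * frechet_derivative (\<lambda>y. J y k i) (at x) (e l)) = 0"
  shows "poisson_on M (tensor_bracket e J)"
proof -
  have lin: "frechet_derivative (\<lambda>y. a * f y + b * g y) (at x) =
      (\<lambda>v. a * frechet_derivative f (at x) v + b * frechet_derivative g (at x) v)"
    if "smooth_on M f" "smooth_on M g" "x \<in> M" for a b x and f g :: "'a \<Rightarrow> real"
    by (intro frechet_derivative_at[symmetric] has_derivative_add has_derivative_mult_right
        smooth_on_has_derivative[OF M] that)
  have prod: "frechet_derivative (\<lambda>y. f y * g y) (at x) =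
      (\<lambda>v. f x * frechet_derivative g (at x) v + frechet_derivative f (at x) v * g x)"
    if "smooth_on M f" "smooth_on M g" "x \<in> M" for x and f g :: "'a \<Rightarrow> real"
    by (intro frechet_derivative_at[symmetric] has_derivative_mult smooth_on_has_derivative[OF M] that)
  have skew: "tensor_bracket e J f g x = - tensor_bracket e J g f x" if "x \<in> M" for f g x
  proof -
    have swap: "J x j i * frechet_derivative f (at x) (e j) * frechet_derivative g (at x) (e i) =
        - (J x i j * frechet_derivative g (at x) (e i) * frechet_derivative f (at x) (e j))" for i j
      using anti[OF that, of j i] by simp
    have "tensor_bracket e J f g x = (\<Sum>i\<in>UNIV. \<Sum>j\<in>UNIV.
        J x j i * frechet_derivative f (at x) (e j) * frechet_derivative g (at x) (e i))"
      unfolding tensor_bracket_def by (rule sum.swap)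
    also have "\<dots> = - tensor_bracket e J g f x"
      unfolding tensor_bracket_def sum_negf [symmetric] swap ..
    finally show ?thesis .
  qed
  have linl: "tensor_bracket e J (\<lambda>y. a * f y + b * g y) h x =
      a * tensor_bracket e J f h x + b * tensor_bracket e J g h x"
    if "smooth_on M f" "smooth_on M g" "x \<in> M" for a b f g h x
    unfolding tensor_bracket_def lin[OF that] sum_distrib_left sum.distrib [symmetric]
    by (intro sum.cong refl) (simp add: algebra_simps)
  have linr: "tensor_bracket e J h (\<lambda>y. a * f y + b * g y) x =
      a * tensor_bracket e J h f x + b * tensor_bracket e J h g x"
    if "smooth_on M f" "smooth_on M g" "x \<in> M" for a b f g h x
    by (simp add: skew[OF that(3), of h] linl[OF that])
  have leibniz: "tensor_bracket e J (\<lambda>y. f y * g y) h x =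
      f x * tensor_bracket e J g h x + g x * tensor_bracket e J f h x"
    if "smooth_on M f" "smooth_on M g" "x \<in> M" for f g h x
    unfolding tensor_bracket_def prod[OF that] sum_distrib_left sum.distrib [symmetric]
    by (intro sum.cong refl) (simp add: algebra_simps)
  have local: "tensor_bracket e J f g x = tensor_bracket e J f' g' x"
    if "smooth_on M f" "smooth_on M g" "\<forall>x\<in>M. f x = f' x" "\<forall>x\<in>M. g x = g' x" "x \<in> M" for f f' g g' x
  proof -
    have "frechet_derivative f (at x) = frechet_derivative f' (at x)"
      using frechet_derivative_cong_open[OF M that(5) smooth_on_differentiable[OF M that(1,5)]] that(3) by blast
    moreover have "frechet_derivative g (at x) = frechet_derivative g' (at x)"
      using frechet_derivative_cong_open[OF M that(5) smooth_on_differentiable[OF M that(2,5)]] that(4) by blast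
    ultimately show ?thesis by (simp add: tensor_bracket_def)
  qed
  have almost: "almost_poisson_on M (tensor_bracket e J)"
    unfolding almost_poisson_on_def
    by (intro conjI allI impI ballI)
      (assumption | rule smooth_on_tensor_bracket[OF M J] local skew linl linr leibniz)+
  have jacobi: "tensor_bracket e J (tensor_bracket e J f g) h x
      + tensor_bracket e J (tensor_bracket e J g h) f x
      + tensor_bracket e J (tensor_bracket e J h f) g x = 0"
    if f: "smooth_on M f" and g: "smooth_on M g" and h: "smooth_on M h" and x: "x \<in> M" for f g h x
    unfolding tensor_bracket_def[of e J "tensor_bracket e J f g" h x]
      tensor_bracket_def[of e J "tensor_bracket e J g h" f x]
      tensor_bracket_def[of e J "tensor_bracket e J h f" g x]
      frechet_derivative_tensor_bracket[OF M x J f g] frechet_derivative_tensor_bracket[OF M x J g h]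
      frechet_derivative_tensor_bracket[OF M x J h f]
    by (rule jacobi_pointwise)
      (rule anti[OF x] cyc[OF x] second_derivative_symmetric[OF M x] f g h)+
  show ?thesis
    unfolding poisson_on_def using almost jacobi by blast
qed

section \<open>The gyroscopic coefficients\<close>

lemma bounded_bilinear_matrix_vector_mult:
  "bounded_bilinear (\<lambda>(A :: real^'n^'m) (x :: real^'n). A *v x)"
  unfolding bilinear_conv_bounded_bilinear [symmetric] bilinear_def
  by (auto intro!: linearI simp: matrix_vector_mult_def vec_eq_iff sum.distrib sum_distrib_left algebra_simps)

lemma smooth_on_curvature:
  fixes B :: "('m::finite, 'g::finite) constraint"
  assumes "open U" "smooth_on U B"
  shows "smooth_on U (curvature B \<alpha> \<mu> \<nu>)"
proof -
  have "smooth_on U (\<lambda>q. B q $ \<alpha> $ i)" for i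
    by (intro smooth_on_linear[OF assms(1) bounded_linear_vec_nth] assms)
  then show ?thesis
    unfolding curvature_def[abs_def] by (intro smooth_on_diff smooth_on_derivative assms(1))
qed

lemma chaplygin_system_open_base:
  assumes "chaplygin_system Q L B"
  shows "open (fst ` Q)"
  using assms by (simp add: chaplygin_system_def open_image_fst)

lemma fibre_point_mem: "q \<in> fst ` Q \<Longrightarrow> (q, fibre_point Q q) \<in> Q"
  unfolding fibre_point_def by (rule someI_ex) force

text \<open>The inverse Legendre transformation does not change the positions.\<close>

lemma legendre_inverse:
  assumes "diffeomorphism (fst ` Q \<times> UNIV) M (legendre Q L B)" "x \<in> M"
  shows "the_inv_into (fst ` Q \<times> UNIV) (legendre Q L B) x \<in> fst ` Q \<times> UNIV"
    and "fst (the_inv_into (fst ` Q \<times> UNIV) (legendre Q L B) x) = fst x"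
proof -
  let ?\<psi> = "the_inv_into (fst ` Q \<times> UNIV) (legendre Q L B)"
  have bij: "bij_betw (legendre Q L B) (fst ` Q \<times> UNIV) M"
    using assms(1) by (simp add: diffeomorphism_def)
  show "?\<psi> x \<in> fst ` Q \<times> UNIV"
    using bij_betw_the_inv_into[OF bij] assms(2) by (auto simp: bij_betw_def)
  have "legendre Q L B (?\<psi> x) = x"
    using f_the_inv_into_f_bij_betw[OF bij] assms(2) by blast
  then show "fst (?\<psi> x) = fst x"
    by (metis (no_types, lifting) case_prod_unfold fst_conv legendre_def)
qed

text \<open>The choice of a point in the fibre over \<open>q\<close> need not depend continuously on \<open>q\<close>. Near a given
  point it may be replaced by a constant, because \<open>L\<close> does not depend on the fibre coordinates.\<close>

lemma smooth_on_constraint_momentum: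
  fixes Q :: "('m::finite, 'g::finite) config set"
  assumes sys: "chaplygin_system Q L B"
    and leg: "diffeomorphism (fst ` Q \<times> UNIV) M (legendre Q L B)"
  shows "smooth_on M (constraint_momentum Q L B \<alpha>)"
proof -
  let ?\<psi> = "the_inv_into (fst ` Q \<times> UNIV) (legendre Q L B)"
  have Q: "open Q" and L: "smooth_on (Q \<times> UNIV) L" and B: "smooth_on (fst ` Q) B"
    and indep: "\<And>q s s' v w. (q, s) \<in> Q \<Longrightarrow> (q, s') \<in> Q \<Longrightarrow> L ((q, s), (v, w)) = L ((q, s'), (v, w))"
    using sys unfolding chaplygin_system_def by blast+
  have M: "open M" and \<psi>: "smooth_on M ?\<psi>"
    using leg by (auto simp: diffeomorphism_def)
  have U: "open (fst ` Q)" by (rule chaplygin_system_open_base[OF sys])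
  have QU: "open (Q \<times> (UNIV :: ('m, 'g) config set))" using Q by (simp add: open_Times)
  show ?thesis
  proof (rule smooth_on_local[OF M])
    fix x0 assume x0: "x0 \<in> M"
    define s where "s = fibre_point Q (fst x0)"
    \<comment> \<open>On \<open>N\<close> the constant \<open>s\<close> is an admissible fibre coordinate, and \<open>y x\<close> is the velocity
      phase point over \<open>(fst x, s)\<close> with the constrained velocity that corresponds to \<open>x\<close>.\<close>
    define N where "N = M \<inter> (\<lambda>x. (fst x, s)) -` Q"
    define y where "y x = ((fst x, s), (snd (?\<psi> x), B (fst x) *v snd (?\<psi> x)))" for x
    have fst_in: "fst x \<in> fst ` Q" if "x \<in> M" for x
      using legendre_inverse[OF leg that] by (metis mem_Times_iff)
    have N: "open N"
      unfolding N_def by (intro continuous_open_preimage[OF _ M Q] continuous_intros)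
    have x0N: "x0 \<in> N"
      using x0 fibre_point_mem[OF fst_in[OF x0]] by (simp add: N_def s_def)
    have eq: "frechet_derivative L (at (y x)) ((0, 0), (0, axis \<alpha> 1)) = constraint_momentum Q L B \<alpha> x"
      if x: "x \<in> N" for x
    proof -
      obtain q v where qv: "?\<psi> x = (q, v)" by (cases "?\<psi> x")
      have xM: "x \<in> M" and sQ: "(fst x, s) \<in> Q" using x by (auto simp: N_def)
      have q: "q = fst x" using legendre_inverse(2)[OF leg xM] qv by simp
      have fQ: "(q, fibre_point Q q) \<in> Q"
        unfolding q by (rule fibre_point_mem[OF fst_in[OF xM]])
      have "(L has_derivative frechet_derivative L (at (y x))) (at (y x))"
        using sQ by (intro smooth_on_has_derivative[OF QU L]) (simp add: y_def)
      moreover have "y x = ((q, s), (v, B q *v v))" by (simp add: y_def q qv)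
      ultimately have L': "(L has_derivative frechet_derivative L (at (y x))) (at ((q, s), (v, B q *v v)))"
        by simp
      have "((\<lambda>w. ((q, s), (v, w))) has_derivative (\<lambda>h. ((0, 0), (0, h)))) (at (B q *v v))"
        by (intro derivative_intros)
      from diff_chain_at[OF this L']
      have "((\<lambda>w. L ((q, s), (v, w))) has_derivative
          (\<lambda>h. frechet_derivative L (at (y x)) ((0, 0), (0, h)))) (at (B q *v v))"
        by (simp add: o_def)
      moreover have "L ((q, s), (v, w)) = L ((q, fibre_point Q q), (v, w))" for w
        using indep fQ sQ q by blast
      ultimately have "((\<lambda>w. L ((q, fibre_point Q q), (v, w))) has_derivative
          (\<lambda>h. frechet_derivative L (at (y x)) ((0, 0), (0, h)))) (at (B q *v v))"
        by simp
      from frechet_derivative_at[OF this, symmetric] show ?thesis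
        by (simp add: constraint_momentum_def qv)
    qed
    have NM: "N \<subseteq> M" by (auto simp: N_def)
    have fst': "smooth_on N fst"
      using smooth_on_linear[OF N bounded_linear_fst smooth_on_ident] .
    have snd': "smooth_on N (\<lambda>x. snd (?\<psi> x))"
      by (rule smooth_on_linear[OF N bounded_linear_snd smooth_on_subset[OF NM \<psi>]])
    have "smooth_on N (\<lambda>x. B (fst x))"
      using fst_in NM by (intro smooth_on_compose[OF N U _ fst' B]) auto
    then have y: "smooth_on N y"
      unfolding y_def[abs_def]
      by (intro smooth_on_Pair[OF N] fst' snd' smooth_on_const
          smooth_on_bilinear[OF N bounded_bilinear_matrix_vector_mult])
    have "y ` N \<subseteq> Q \<times> UNIV" by (auto simp: y_def N_def)
    then have DL: "smooth_on N (\<lambda>x. frechet_derivative L (at (y x)) ((0, 0), (0, axis \<alpha> 1)))"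
      by (rule smooth_on_compose[OF N QU _ y smooth_on_derivative[OF L]])
    have "smooth_on N (constraint_momentum Q L B \<alpha>)"
      by (rule smooth_on_cong[OF N _ DL]) (rule eq)
    then show "\<exists>U. open U \<and> x0 \<in> U \<and> smooth_on U (constraint_momentum Q L B \<alpha>)"
      using N x0N by blast
  qed
qed

lemma smooth_on_gyro:
  assumes sys: "chaplygin_system Q L B"
    and leg: "diffeomorphism (fst ` Q \<times> UNIV) M (legendre Q L B)"
  shows "smooth_on M (\<lambda>x. gyro Q L B x \<mu> \<nu>)"
proof -
  have M: "open M" using leg by (simp add: diffeomorphism_def)
  have U: "open (fst ` Q)" by (rule chaplygin_system_open_base[OF sys])
  have fst_in: "fst ` M \<subseteq> fst ` Q"
    using legendre_inverse[OF leg] by (metis image_subsetI mem_Times_iff)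
  have "smooth_on (fst ` Q) (curvature B \<alpha> \<mu> \<nu>)" for \<alpha>
    using sys by (intro smooth_on_curvature U) (simp add: chaplygin_system_def)
  then have "smooth_on M (\<lambda>x. curvature B \<alpha> \<mu> \<nu> (fst x))" for \<alpha>
    by (rule smooth_on_compose[OF M U fst_in smooth_on_linear[OF M bounded_linear_fst smooth_on_ident]])
  then show ?thesis
    unfolding gyro_def
    by (intro smooth_on_sum[OF M] smooth_on_mult[OF M] smooth_on_constraint_momentum[OF sys leg])
qed

lemma fundamental_form_coord:
  "fundamental_form Q L B x (coord_vec (Inl \<mu>)) (coord_vec (Inl \<nu>)) = gyro Q L B x \<mu> \<nu>"
  "fundamental_form Q L B x (coord_vec (Inl \<mu>)) (coord_vec (Inr \<nu>)) = - (if \<mu> = \<nu> then 1 else 0)"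
proof -
  have "fundamental_form Q L B x (coord_vec i) (coord_vec j) = form_matrix (fundamental_form Q L B x) $ i $ j" for i j
    by (simp add: form_matrix_def)
  then show "fundamental_form Q L B x (coord_vec (Inl \<mu>)) (coord_vec (Inl \<nu>)) = gyro Q L B x \<mu> \<nu>"
    "fundamental_form Q L B x (coord_vec (Inl \<mu>)) (coord_vec (Inr \<nu>)) = - (if \<mu> = \<nu> then 1 else 0)"
    by (simp_all add: fundamental_matrix_blocks)
qed

text \<open>Closedness in components: the \<open>dp dq dq\<close> components of \<open>d\<Omega> = 0\<close> say that the coefficients do
  not depend on the momenta, and the \<open>dq dq dq\<close> components are a cyclic identity. Differentiability
  is needed for the derivatives of the coefficients to inherit antisymmetry.\<close>

lemma closed_fundamental_form_components:
  assumes "closed_form2_on M (fundamental_form Q L B)" "x \<in> M"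
    and diff: "\<And>\<mu> \<nu>. (\<lambda>y. gyro Q L B y \<mu> \<nu>) differentiable (at x)"
  shows "frechet_derivative (\<lambda>y. gyro Q L B y \<mu> \<nu>) (at x) (coord_vec (Inr \<kappa>)) = 0"
    and "frechet_derivative (\<lambda>y. gyro Q L B y \<mu> \<nu>) (at x) (coord_vec (Inl \<kappa>))
      + frechet_derivative (\<lambda>y. gyro Q L B y \<nu> \<kappa>) (at x) (coord_vec (Inl \<mu>))
      + frechet_derivative (\<lambda>y. gyro Q L B y \<kappa> \<mu>) (at x) (coord_vec (Inl \<nu>)) = 0"
proof -
  have d: "ext_deriv2 (fundamental_form Q L B) x u v w = 0" for u v w
    using assms(1,2) unfolding closed_form2_on_def by blast
  show "frechet_derivative (\<lambda>y. gyro Q L B y \<mu> \<nu>) (at x) (coord_vec (Inr \<kappa>)) = 0"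
    using d[of "coord_vec (Inl \<mu>)" "coord_vec (Inl \<nu>)" "coord_vec (Inr \<kappa>)"]
    unfolding ext_deriv2_def fundamental_form_coord by simp
  have "((\<lambda>y. - gyro Q L B y \<kappa> \<mu>) has_derivative (\<lambda>v. - frechet_derivative (\<lambda>y. gyro Q L B y \<kappa> \<mu>) (at x) v)) (at x)"
    using diff[of \<kappa> \<mu>] by (intro has_derivative_minus) (simp add: frechet_derivative_works)
  then have "frechet_derivative (\<lambda>y. gyro Q L B y \<mu> \<kappa>) (at x) =
      (\<lambda>v. - frechet_derivative (\<lambda>y. gyro Q L B y \<kappa> \<mu>) (at x) v)"
    unfolding gyro_antisym[of Q L B _ \<kappa> \<mu>] minus_minus by (rule frechet_derivative_at[symmetric])
  then show "frechet_derivative (\<lambda>y. gyro Q L B y \<mu> \<nu>) (at x) (coord_vec (Inl \<kappa>))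
      + frechet_derivative (\<lambda>y. gyro Q L B y \<nu> \<kappa>) (at x) (coord_vec (Inl \<mu>))
      + frechet_derivative (\<lambda>y. gyro Q L B y \<kappa> \<mu>) (at x) (coord_vec (Inl \<nu>)) = 0"
    using d[of "coord_vec (Inl \<mu>)" "coord_vec (Inl \<nu>)" "coord_vec (Inl \<kappa>)"]
    unfolding ext_deriv2_def fundamental_form_coord by simp
qed

section \<open>The pencil of brackets\<close>

text \<open>The bivector of \<open>a {f, g} + b [[f, g]]\<close>, the linear combinations of the canonical bracket and
  the gyroscopic bracket.\<close>

definition pencil_matrix ::
  "real \<Rightarrow> real \<Rightarrow> ('m::finite, 'g::finite) config set \<Rightarrow> ('m, 'g) lagrangian \<Rightarrow> ('m, 'g) constraint \<Rightarrow>
   'm phase \<Rightarrow> 'm + 'm \<Rightarrow> 'm + 'm \<Rightarrow> real" where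
  "pencil_matrix a b Q L B x i j = (case (i, j) of
      (Inl \<mu>, Inl \<nu>) \<Rightarrow> 0
    | (Inl \<mu>, Inr \<nu>) \<Rightarrow> (if \<mu> = \<nu> then a else 0)
    | (Inr \<mu>, Inl \<nu>) \<Rightarrow> - (if \<mu> = \<nu> then a else 0)
    | (Inr \<mu>, Inr \<nu>) \<Rightarrow> b * gyro Q L B x \<mu> \<nu>)"

lemma pencil_matrix_simps [simp]:
  "pencil_matrix a b Q L B x (Inl \<mu>) (Inl \<nu>) = 0"
  "pencil_matrix a b Q L B x (Inl \<mu>) (Inr \<nu>) = (if \<mu> = \<nu> then a else 0)"
  "pencil_matrix a b Q L B x (Inr \<mu>) (Inl \<nu>) = - (if \<mu> = \<nu> then a else 0)"
  "pencil_matrix a b Q L B x (Inr \<mu>) (Inr \<nu>) = b * gyro Q L B x \<mu> \<nu>"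
  by (simp_all add: pencil_matrix_def)

lemma sum_UNIV_Plus:
  fixes h :: "'i::finite + 'j::finite \<Rightarrow> 'b::comm_monoid_add"
  shows "(\<Sum>i\<in>UNIV. h i) = (\<Sum>\<mu>\<in>UNIV. h (Inl \<mu>)) + (\<Sum>\<mu>\<in>UNIV. h (Inr \<mu>))"
  unfolding UNIV_Plus_UNIV [symmetric] by (subst sum.Plus) auto

lemma tensor_bracket_pencil:
  "tensor_bracket coord_vec (pencil_matrix a b Q L B) f g x =
    a * canonical_bracket f g x + b * gyro_bracket Q L B f g x"
  by (simp add: tensor_bracket_def canonical_bracket_def gyro_bracket_def coord_deriv_def sum_UNIV_Plus
      mult_delta_left sum.distrib sum_subtractf sum_negf sum_distrib_left right_diff_distrib mult.assoc)

lemma almost_poisson_bracket_eq: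
  "almost_poisson_bracket Q L B = tensor_bracket coord_vec (pencil_matrix 1 1 Q L B)"
proof -
  have "matrix_inv (form_matrix (fundamental_form Q L B x)) $ i $ j = pencil_matrix 1 1 Q L B x i j" for x i j
    by (simp add: poisson_matrix_blocks pencil_matrix_def split: sum.split)
  then show ?thesis
    by (simp add: fun_eq_iff almost_poisson_bracket_def tensor_bracket_def coord_deriv_def)
qed

text \<open>If \<open>\<Omega>\<close> is closed, every member of the pencil is a Poisson bracket: in the cyclic sum which
  governs the Jacobi identity only the derivatives of the gyroscopic coefficients with respect to the
  positions survive, and they enter through their cyclic sum.\<close>

lemma poisson_on_pencil:
  assumes sys: "chaplygin_system Q L B"
    and leg: "diffeomorphism (fst ` Q \<times> UNIV) M (legendre Q L B)"
    and closed: "closed_form2_on M (fundamental_form Q L B)"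
  shows "poisson_on M (tensor_bracket coord_vec (pencil_matrix a b Q L B))"
proof (rule poisson_on_tensor_bracket)
  show M: "open M" using leg by (simp add: diffeomorphism_def)
  note smooth = smooth_on_gyro[OF sys leg]
  show "smooth_on M (\<lambda>x. pencil_matrix a b Q L B x i j)" for i j
    by (cases i; cases j)
      (simp_all add: smooth_on_const smooth smooth_on_linear[OF M bounded_linear_mult_right])
  show "pencil_matrix a b Q L B x j i = - pencil_matrix a b Q L B x i j" for x i j
    using gyro_antisym[of Q L B x "projr j" "projr i"] by (cases i; cases j) simp_all
  fix x i j k assume x: "x \<in> M"
  have diff: "(\<lambda>y. gyro Q L B y \<mu> \<nu>) differentiable (at x)" for \<mu> \<nu>
    by (rule smooth_on_differentiable[OF M smooth x])
  note comp = closed_fundamental_form_components[OF closed x diff]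
  have D: "frechet_derivative (\<lambda>y. b * gyro Q L B y \<mu> \<nu>) (at x) v =
      b * frechet_derivative (\<lambda>y. gyro Q L B y \<mu> \<nu>) (at x) v" for \<mu> \<nu> v
  proof -
    have "((\<lambda>y. b * gyro Q L B y \<mu> \<nu>) has_derivative
        (\<lambda>v. b * frechet_derivative (\<lambda>y. gyro Q L B y \<mu> \<nu>) (at x) v)) (at x)"
      using diff by (intro has_derivative_mult_right) (simp add: frechet_derivative_works)
    from frechet_derivative_at[OF this, symmetric] show ?thesis by simp
  qed
  have cyc: "a * (b * frechet_derivative (\<lambda>y. gyro Q L B y \<mu> \<nu>) (at x) (coord_vec (Inl \<kappa>)))
      + a * (b * frechet_derivative (\<lambda>y. gyro Q L B y \<nu> \<kappa>) (at x) (coord_vec (Inl \<mu>)))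
      + a * (b * frechet_derivative (\<lambda>y. gyro Q L B y \<kappa> \<mu>) (at x) (coord_vec (Inl \<nu>))) = 0" for \<mu> \<nu> \<kappa>
    using comp(2)[of \<mu> \<nu> \<kappa>] by (simp add: distrib_left [symmetric])
  show "(\<Sum>l\<in>UNIV. pencil_matrix a b Q L B x l k * frechet_derivative (\<lambda>y. pencil_matrix a b Q L B y i j) (at x) (coord_vec l)
      + pencil_matrix a b Q L B x l i * frechet_derivative (\<lambda>y. pencil_matrix a b Q L B y j k) (at x) (coord_vec l)
      + pencil_matrix a b Q L B x l j * frechet_derivative (\<lambda>y. pencil_matrix a b Q L B y k i) (at x) (coord_vec l)) = 0"
    by (cases i; cases j; cases k)
      (simp_all add: sum_UNIV_Plus sum.distrib D comp(1) mult_delta_left cyc)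
qed

theorem theorem3p1:
  fixes Q :: "('m::finite, 'g::finite) config set"
    and L :: "('m, 'g) lagrangian"
    and B :: "('m, 'g) constraint"
    and M :: "'m phase set"
  assumes "chaplygin_system Q L B"
    and "regular_lagrangian_on (fst ` Q) (reduced_lagrangian Q L B)"
    and "diffeomorphism (fst ` Q \<times> UNIV) M (legendre Q L B)"
    and "closed_form2_on M (fundamental_form Q L B)"
  shows "poisson_on M (almost_poisson_bracket Q L B) \<and>
    (\<forall>f g. smooth_on M f \<longrightarrow> smooth_on M g \<longrightarrow> (\<forall>x\<in>M.
       almost_poisson_bracket Q L B f g x = canonical_bracket f g x + gyro_bracket Q L B f g x)) \<and>
    poisson_on M canonical_bracket \<and>
    poisson_on M (gyro_bracket Q L B)"
proof -
  have can: "canonical_bracket = tensor_bracket coord_vec (pencil_matrix 1 0 Q L B)"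
    and gyr: "gyro_bracket Q L B = tensor_bracket coord_vec (pencil_matrix 0 1 Q L B)"
    by (simp_all add: fun_eq_iff tensor_bracket_pencil)
  have "almost_poisson_bracket Q L B f g x = canonical_bracket f g x + gyro_bracket Q L B f g x" for f g x
    by (simp add: almost_poisson_bracket_eq tensor_bracket_pencil)
  moreover have "poisson_on M (almost_poisson_bracket Q L B)" "poisson_on M canonical_bracket"
    "poisson_on M (gyro_bracket Q L B)"
    unfolding almost_poisson_bracket_eq can gyr by (rule poisson_on_pencil[OF assms(1,3,4)])+
  ultimately show ?thesis by blast
qed

end
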